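(* Let $S$ be a topological distributive lattice with finite breadth $b$, equipped with its algebraic semilattice convexity (convex subsets are the subsets closed under the join $\oplus$). Let $K$ be a compact convex subset of $S$. Then every $x\in K$ can be written as the convex combination of at most $b$ extreme points of $K$, i.e. $x=\bigoplus G$ for some nonempty set $G\subset\operatorname{ex}K$ with at most $b$ elements.
   Context: A topological lattice is a lattice with a Hausdorff topology for which both join $\oplus$ and meet are jointly continuous. For a finite nonempty set $F$, $\bigoplus F$ denotes its join. The breadth of a semilattice $(S,\oplus)$ is the least integer $b$ such that every nonempty finite subset $F$ of $S$ contains a nonempty subset $G\subset F$ with at most $b$ elements such that $\bigoplus F=\bigoplus G$; here breadth is that of the join-semilattice $(S,\oplus)$. $\operatorname{co}(A)$ denotes the join-subsemilattice generated by $A$ (with $\operatorname{co}(\emptyset)=\emptyset$). A point $x\in K$ is an extreme point of $K$ if $x\notin\operatorname{co}(K\setminus\{x\})$; $\operatorname{ex}K$ is the set of extreme points of $K$. *)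

theory Defs
  imports "HOL-Analysis.Analysis"
begin

text \<open>Joint continuity is phrased with \<open>\<times>\<^sub>F\<close>, as in \<open>topological_monoid_add\<close>, because the
  product topology is not available inside a class specification; the lemmas below
  restate it for the product topology.\<close>

class topological_lattice = lattice + t2_space +
  assumes tendsto_sup_Pair: "LIM x (nhds a \<times>\<^sub>F nhds b). sup (fst x) (snd x) :> nhds (sup a b)"
    and tendsto_inf_Pair: "LIM x (nhds a \<times>\<^sub>F nhds b). inf (fst x) (snd x) :> nhds (inf a b)"

lemma continuous_on_sup_Pair:
  "continuous_on UNIV (\<lambda>p::'a::topological_lattice \<times> 'a. sup (fst p) (snd p))"
  unfolding continuous_on_def
  by (auto intro!: filterlim_mono[OF tendsto_sup_Pair] at_le simp: at_within_def nhds_prod inf_le1)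

lemma continuous_on_inf_Pair:
  "continuous_on UNIV (\<lambda>p::'a::topological_lattice \<times> 'a. inf (fst p) (snd p))"
  unfolding continuous_on_def
  by (auto intro!: filterlim_mono[OF tendsto_inf_Pair] at_le simp: at_within_def nhds_prod inf_le1)

definition breadth_at_most :: "'a::semilattice_sup set \<Rightarrow> nat \<Rightarrow> bool" where
  "breadth_at_most S n \<longleftrightarrow>
    (\<forall>F. F \<noteq> {} \<and> finite F \<and> F \<subseteq> S \<longrightarrow>
      (\<exists>G. G \<noteq> {} \<and> G \<subseteq> F \<and> card G \<le> n \<and> Sup_fin F = Sup_fin G))"

text \<open>The semilattice has finite breadth, equal to \<open>b\<close>. A relation rather than a
  function, since the breadth need not exist as a natural number.\<close>

definition has_breadth :: "'a::semilattice_sup set \<Rightarrow> nat \<Rightarrow> bool" where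
  "has_breadth S b \<longleftrightarrow> breadth_at_most S b \<and> (\<forall>n. breadth_at_most S n \<longrightarrow> b \<le> n)"

definition join_convex :: "'a::semilattice_sup set \<Rightarrow> bool" where
  "join_convex C \<longleftrightarrow> (\<forall>x\<in>C. \<forall>y\<in>C. sup x y \<in> C)"

text \<open>The empty set is join-convex, so \<open>join_co {} = {}\<close>.\<close>

definition join_co :: "'a::semilattice_sup set \<Rightarrow> 'a set" where
  "join_co A = join_convex hull A"

definition join_extreme_points :: "'a::semilattice_sup set \<Rightarrow> 'a set" where
  "join_extreme_points K = {x \<in> K. x \<notin> join_co (K - {x})}"

end

theory Submission
  imports Defs
begin

text \<open>
  A point of a join-convex set \<open>K\<close> is extreme iff it is not the join of two other points of \<open>K\<close>.
  Write \<open>x\<close> as an irredundant join of a finite subset \<open>F\<close> of \<open>K\<close>, meaning that no proper part of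
  \<open>F\<close> has join \<open>x\<close>. Finite breadth \<open>b\<close> bounds the number of joinands by \<open>b\<close>, and \<open>{x}\<close> is one
  such \<open>F\<close>, so there is an \<open>F\<close> of largest possible size.

  Fix a joinand \<open>y\<close> of such a largest \<open>F\<close>. The points of \<open>K\<close> below \<open>y\<close> that can
  replace \<open>y\<close> without changing the join form a nonempty compact set, which therefore has a minimal
  element \<open>m\<close>. Exchanging \<open>y\<close> for \<open>m\<close> keeps the join irredundant and of the same size. Moreover
  \<open>m\<close> is extreme: if \<open>m\<close> were the join of two other points \<open>u\<close> and \<open>v\<close> of \<open>K\<close>, then putting both
  of them in the place of \<open>m\<close> would give an irredundant join with one more joinand. Here \<open>u\<close> and
  \<open>v\<close> are indispensable because \<open>m\<close> is minimal, and the other joinands because they already were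
  indispensable next to \<open>m\<close>. So if \<open>F\<close> is chosen, among the largest
  irredundant joins, with as many extreme points as possible, all its members are extreme.
\<close>

section \<open>Minimal elements of compact sets\<close>

lemma closed_Collect_Sup_fin_insert_eq:
  fixes x :: "'a::topological_lattice"
  assumes "finite A"
  shows "closed {u. Sup_fin (insert u A) = x}"
proof (cases "A = {}")
  case False
  have "continuous_on UNIV (\<lambda>u. sup u (Sup_fin A))"
    using continuous_on_compose2[OF continuous_on_sup_Pair
        continuous_on_Pair[OF continuous_on_id continuous_on_const] subset_UNIV]
    unfolding fst_conv snd_conv by this
  then have "closed {u. sup u (Sup_fin A) = x}"
    by (intro closed_Collect_eq continuous_on_const)
  then show ?thesis
    using assms False by simp
qed simp

lemma closed_atMost_topological_lattice:
  fixes a :: "'a::topological_lattice"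
  shows "closed {..a}"
proof -
  have "{..a} = {u. Sup_fin (insert u {a}) = a}"
    by (simp add: set_eq_iff sup.absorb_iff2[symmetric])
  then show ?thesis
    using closed_Collect_Sup_fin_insert_eq[of "{a}" a] by simp
qed

text \<open>Lower bounds of chains come from the finite intersection property of the closed down-sets, so
  Zorn's lemma applies.\<close>

lemma compact_has_minimal_element:
  fixes T :: "'a::topological_lattice set"
  assumes "compact T" "T \<noteq> {}"
  obtains m where "m \<in> T" "\<And>u. u \<in> T \<Longrightarrow> u \<le> m \<Longrightarrow> u = m"
proof -
  have "\<exists>m\<in>T. \<forall>u\<in>T. m \<ge> u \<longrightarrow> u = m"
  proof (rule predicate_Zorn)
    show "partial_order_on T (relation_of (\<ge>) T)"
      by (rule partial_order_on_relation_ofI) auto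
  next
    fix C assume C: "C \<in> Chains (relation_of (\<ge>) T)"
    then have CT: "C \<subseteq> T"
      and lin: "\<And>a b. a \<in> C \<Longrightarrow> b \<in> C \<Longrightarrow> a \<le> b \<or> b \<le> a"
      by (auto simp: Chains_def relation_of_def)
    have fin: "\<exists>l\<in>T. \<forall>a\<in>D. l \<le> a" if "finite D" "D \<subseteq> C" for D
    proof (cases "D = {}")
      case True
      then show ?thesis using assms by auto
    next
      case False
      have "\<exists>l\<in>D. \<forall>a\<in>D. l \<le> a"
        using that(1) False that(2)
      proof (induction rule: finite_ne_induct)
        case (insert a D)
        then obtain l where l: "l \<in> D" "\<forall>b\<in>D. l \<le> b" by auto
        then have "l \<le> a \<or> a \<le> l" using lin insert.prems by auto
        then show ?case using l by (auto intro: order_trans)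
      qed auto
      then show ?thesis using that CT by blast
    qed
    have "T \<inter> (\<Inter>a\<in>C. {..a}) \<noteq> {}"
    proof (rule compact_imp_fip_image[OF assms(1)])
      show "closed {..a}" for a :: 'a
        by (rule closed_atMost_topological_lattice)
      show "T \<inter> (\<Inter>a\<in>D. {..a}) \<noteq> {}" if "finite D" "D \<subseteq> C" for D
        using fin[OF that] by auto
    qed
    then show "\<exists>l\<in>T. \<forall>a\<in>C. a \<ge> l" by auto
  qed
  then show ?thesis using that by blast
qed

section \<open>Extreme points and irredundant joins\<close>

lemma not_extreme_imp_join_of_two_others:
  assumes "join_convex K" "y \<in> K" "y \<notin> join_extreme_points K"
  obtains u v where "u \<in> K" "v \<in> K" "u \<noteq> y" "v \<noteq> y" "y = sup u v"
proof -
  have "y \<in> join_convex hull (K - {y})"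
    using assms by (auto simp: join_extreme_points_def join_co_def)
  then have "\<not> join_convex (K - {y})"
    using hull_minimal[OF order_refl, of join_convex "K - {y}"] by auto
  then show ?thesis
    using assms(1) that unfolding join_convex_def by blast
qed

text \<open>The empty subset is excluded because \<open>Sup_fin {}\<close> is unspecified; a singleton is thus always an
  irredundant join.\<close>

definition irredundant_join :: "'a::semilattice_sup set \<Rightarrow> 'a \<Rightarrow> bool" where
  "irredundant_join F x \<longleftrightarrow> finite F \<and> F \<noteq> {} \<and> Sup_fin F = x \<and>
    (\<forall>G. G \<subset> F \<and> G \<noteq> {} \<longrightarrow> Sup_fin G \<noteq> x)"

lemma irredundant_joinD:
  assumes "irredundant_join F x"
  shows "finite F" "F \<noteq> {}" "Sup_fin F = x"
    and "\<And>G. G \<subseteq> F \<Longrightarrow> G \<noteq> {} \<Longrightarrow> Sup_fin G = x \<Longrightarrow> G = F"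
  using assms by (auto simp: irredundant_join_def psubset_eq)

lemma irredundant_join_card_le_breadth:
  fixes x :: "'a::semilattice_sup"
  assumes "irredundant_join F x" "breadth_at_most (UNIV :: 'a set) b"
  shows "card F \<le> b"
proof -
  obtain G where "G \<noteq> {}" "G \<subseteq> F" "card G \<le> b" "Sup_fin F = Sup_fin G"
    using assms(2)[unfolded breadth_at_most_def, rule_format, of F] irredundant_joinD(1,2)[OF assms(1)]
    by auto
  then show ?thesis
    using irredundant_joinD(3,4)[OF assms(1)] by metis
qed

lemma Sup_fin_eq_if_between:
  fixes A B C :: "'a::semilattice_sup set"
  assumes "finite A" "finite B" "A \<noteq> {}" "B \<noteq> {}"
    and "Sup_fin A = x" "Sup_fin C = x"
    and "\<And>a. a \<in> A \<Longrightarrow> a \<le> Sup_fin B" "\<And>b. b \<in> B \<Longrightarrow> b \<le> Sup_fin C"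
  shows "Sup_fin B = x"
proof (rule antisym)
  show "Sup_fin B \<le> x"
    using Sup_fin.boundedI[OF assms(2,4) assms(8)] assms(6) by simp
  show "x \<le> Sup_fin B"
    using Sup_fin.boundedI[OF assms(1,3) assms(7)] assms(5) by simp
qed

section \<open>Exchanging joinands\<close>

text \<open>The larger joinand \<open>y\<close> could stand in for \<open>m\<close> in any proper subfamily with join \<open>x\<close>, so
  redundancy after the exchange would mean redundancy before it.\<close>

lemma irredundant_join_exchange_smaller:
  assumes F: "irredundant_join F x" and y: "y \<in> F"
    and m: "m \<le> y" "Sup_fin (insert m (F - {y})) = x"
  shows "irredundant_join (insert m (F - {y})) x" and "m \<notin> F - {y}"
proof -
  note D = irredundant_joinD[OF F]
  show new: "m \<notin> F - {y}"
  proof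
    assume "m \<in> F - {y}"
    then have "Sup_fin (F - {y}) = x" "F - {y} \<noteq> {}"
      using m(2) by (auto simp: insert_absorb)
    then show False using D(4)[of "F - {y}"] y by auto
  qed
  have "G = insert m (F - {y})"
    if G: "G \<subseteq> insert m (F - {y})" "G \<noteq> {}" "Sup_fin G = x" for G
  proof -
    have finG: "finite G" using G(1) D(1) by (auto intro: finite_subset)
    have mG: "m \<in> G"
      using D(4)[of G] G y by auto
    have "Sup_fin (insert y (G - {m})) = x"
    proof (rule Sup_fin_eq_if_between[where A = G and C = F])
      show "a \<le> Sup_fin (insert y (G - {m}))" if "a \<in> G" for a
      proof (cases "a = m")
        case True
        have "y \<le> Sup_fin (insert y (G - {m}))"
          using finG by (intro Sup_fin.coboundedI) auto
        then show ?thesis using True m(1) by simp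
      next
        case False
        then show ?thesis
          using finG that by (intro Sup_fin.coboundedI) auto
      qed
      show "c \<le> Sup_fin F" if "c \<in> insert y (G - {m})" for c
        using that G(1) y D(1) by (intro Sup_fin.coboundedI) auto
    qed (use G D finG in auto)
    then have "insert y (G - {m}) = F"
      using D(4)[of "insert y (G - {m})"] G(1) y by auto
    then show ?thesis using mG G(1) by auto
  qed
  then show "irredundant_join (insert m (F - {y})) x"
    using D m(2) by (auto simp: irredundant_join_def)
qed

text \<open>If neither half of \<open>m = sup u v\<close> can replace \<open>m\<close> alone, then both halves together can be put
  in its place and nothing becomes redundant: what is needed next to \<open>m\<close> is needed next to \<open>u\<close> and
  \<open>v\<close>.\<close>

lemma irredundant_join_split:
  assumes irr: "irredundant_join (insert (sup u v) A) x" and A: "sup u v \<notin> A"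
    and u: "Sup_fin (insert u A) \<noteq> x" and v: "Sup_fin (insert v A) \<noteq> x"
  shows "irredundant_join (insert u (insert v A)) x"
    and "card (insert u (insert v A)) = Suc (card (insert (sup u v) A))"
proof -
  note D = irredundant_joinD[OF irr]
  have finA: "finite A" using D(1) by simp
  have join: "Sup_fin (insert u (insert v B)) = Sup_fin (insert (sup u v) B)" if "finite B" for B
    using that by (cases "B = {}") (auto simp: sup.assoc)
  have whole: "Sup_fin (insert u (insert v A)) = x"
    using join[OF finA] D(3) by simp
  have above: "Sup_fin B = x"
    if "G \<subseteq> B" "B \<subseteq> insert u (insert v A)" "G \<noteq> {}" "Sup_fin G = x" for G B
  proof (rule Sup_fin_eq_if_between[where A = G and C = "insert u (insert v A)"])
    have finB: "finite B" using that(2) finA by (auto intro: finite_subset)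
    then show "finite B" "finite G" using that(1) by (auto intro: finite_subset)
    show "a \<le> Sup_fin B" if "a \<in> G" for a
      using that \<open>G \<subseteq> B\<close> finB by (auto intro: Sup_fin.coboundedI)
    show "a \<le> Sup_fin (insert u (insert v A))" if "a \<in> B" for a
      using that \<open>B \<subseteq> insert u (insert v A)\<close> finA by (intro Sup_fin.coboundedI) auto
  qed (use that whole finA in auto)
  have "u \<notin> A" "v \<notin> A"
    using u v whole by (auto simp: insert_absorb insert_commute)
  moreover have "u \<noteq> v"
    using u whole by auto
  ultimately show "card (insert u (insert v A)) = Suc (card (insert (sup u v) A))"
    using finA A by simp
  have "G = insert u (insert v A)"
    if G: "G \<subseteq> insert u (insert v A)" "G \<noteq> {}" "Sup_fin G = x" for G
  proof -
    \<comment> \<open>Otherwise \<open>v\<close> alone could replace \<open>sup u v\<close>, and symmetrically for \<open>v\<close>.\<close>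
    have "u \<in> G"
      using above[of G "insert v A"] G v by blast
    moreover have "v \<in> G"
      using above[of G "insert u A"] G u by blast
    ultimately have "Sup_fin (insert (sup u v) (G \<inter> A)) = x"
      using join[of "G \<inter> A"] finA G
      by (metis Int_insert_right_if1 finite_Int inf.absorb1)
    then have "insert (sup u v) (G \<inter> A) = insert (sup u v) A"
      by (intro D(4)) auto
    then have "A \<subseteq> G" using A by (metis IntD2 Int_lower1 insert_ident)
    then show ?thesis using \<open>u \<in> G\<close> \<open>v \<in> G\<close> G(1) by auto
  qed
  then show "irredundant_join (insert u (insert v A)) x"
    using finA whole by (auto simp: irredundant_join_def)
qed

text \<open>The one step that uses compactness: a minimal replacement of \<open>y\<close> exists, and splitting it
  would contradict the maximality of the number of joinands.\<close>

lemma exchange_joinand_for_extreme_point: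
  fixes K :: "'a::topological_lattice set"
  assumes K: "compact K" "join_convex K"
    and F: "irredundant_join F x" "F \<subseteq> K" and y: "y \<in> F"
    and largest: "\<And>F'. irredundant_join F' x \<Longrightarrow> F' \<subseteq> K \<Longrightarrow> card F' \<le> card F"
  obtains m where "m \<in> join_extreme_points K" "m \<notin> F - {y}"
    "irredundant_join (insert m (F - {y})) x"
proof -
  note D = irredundant_joinD[OF F(1)]
  define A where "A = F - {y}"
  define T where "T = K \<inter> ({..y} \<inter> {u. Sup_fin (insert u A) = x})"
  have finA: "finite A" using D(1) by (simp add: A_def)
  have "compact T"
    unfolding T_def
    by (intro compact_Int_closed K closed_Int closed_atMost_topological_lattice
        closed_Collect_Sup_fin_insert_eq finA)
  moreover have "y \<in> T"
    using y F(2) D(3) by (auto simp: T_def A_def insert_absorb)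
  ultimately obtain m where m: "m \<in> T" and min: "\<And>u. u \<in> T \<Longrightarrow> u \<le> m \<Longrightarrow> u = m"
    using compact_has_minimal_element by blast
  have mK: "m \<in> K" and my: "m \<le> y" and mx: "Sup_fin (insert m A) = x"
    using m by (auto simp: T_def)
  note ex = irredundant_join_exchange_smaller[OF F(1) y my mx[unfolded A_def], folded A_def]
  have "m \<in> join_extreme_points K"
  proof (rule ccontr)
    assume "m \<notin> join_extreme_points K"
    then obtain u v where uv: "u \<in> K" "v \<in> K" "u \<noteq> m" "v \<noteq> m" and m_eq: "m = sup u v"
      using not_extreme_imp_join_of_two_others[OF K(2) mK] by metis
    have le: "u \<le> m" "v \<le> m" by (auto simp: m_eq)
    have ne: "Sup_fin (insert w A) \<noteq> x" if "w \<in> K" "w \<le> m" "w \<noteq> m" for w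
      using min[of w] that order_trans[OF that(2) my] by (auto simp: T_def)
    have irr: "irredundant_join (insert u (insert v A)) x"
      and card: "card (insert u (insert v A)) = Suc (card (insert m A))"
      using irredundant_join_split[OF ex[unfolded m_eq] ne[of u] ne[of v]] uv le
      by (simp_all add: m_eq)
    have "card (insert m A) = card F"
      using ex(2) finA card.remove[OF D(1) y] by (simp add: A_def)
    moreover have "insert u (insert v A) \<subseteq> K"
      using uv F(2) by (auto simp: A_def)
    ultimately show False using largest[OF irr] card by simp
  qed
  then show ?thesis using that ex by (simp add: A_def)
qed

section \<open>Joins of extreme points\<close>

theorem theorem6p4:
  fixes K :: "'a::{topological_lattice, distrib_lattice} set" and b :: nat
  assumes "has_breadth (UNIV :: 'a set) b"
    and "compact K"
    and "join_convex K"
  shows "\<forall>x\<in>K. \<exists>G. G \<noteq> {} \<and> G \<subseteq> join_extreme_points K \<and> finite G \<and> card G \<le> b \<and> x = Sup_fin G"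
proof
  fix x assume "x \<in> K"
  define E where "E = join_extreme_points K"
  define R where "R F \<longleftrightarrow> irredundant_join F x \<and> F \<subseteq> K" for F
  have bounded: "card F \<le> b" if "R F" for F
    using that assms(1) irredundant_join_card_le_breadth
    by (auto simp: R_def has_breadth_def)
  have "R {x}"
    using \<open>x \<in> K\<close> by (auto simp: R_def irredundant_join_def)
  then obtain F0 where F0: "R F0" "\<And>F. R F \<Longrightarrow> card F \<le> card F0"
    using Lattices_Big.ex_has_greatest_nat[of R "{x}" card "Suc b"] bounded
    by (auto simp: less_Suc_eq_le)
  define M where "M F \<longleftrightarrow> R F \<and> card F = card F0" for F
  have "card (F \<inter> E) \<le> b" if "M F" for F
    using that bounded[of F] irredundant_joinD(1)[of F x] card_mono[of F "F \<inter> E"]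
    by (auto simp: M_def R_def)
  then obtain F where F: "M F" and most: "\<And>F'. M F' \<Longrightarrow> card (F' \<inter> E) \<le> card (F \<inter> E)"
    using Lattices_Big.ex_has_greatest_nat[of M F0 "\<lambda>F. card (F \<inter> E)" "Suc b"] F0(1)
    by (auto simp: M_def less_Suc_eq_le)
  have irr: "irredundant_join F x" and FK: "F \<subseteq> K" and cF: "card F = card F0"
    using F by (auto simp: M_def R_def)
  note D = irredundant_joinD[OF irr]
  have "F \<subseteq> E"
  proof (rule ccontr)
    assume "\<not> F \<subseteq> E"
    then obtain y where y: "y \<in> F" "y \<notin> E" by auto
    obtain m where m: "m \<in> E" "m \<notin> F - {y}" "irredundant_join (insert m (F - {y})) x"
      using exchange_joinand_for_extreme_point[OF assms(2,3) irr FK y(1)] F0(2) cF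
      by (metis E_def R_def)
    have "card (insert m (F - {y})) = card F"
      using m(2) D(1) card.remove[OF D(1) y(1)] by simp
    moreover have "m \<in> K"
      using m(1) by (simp add: E_def join_extreme_points_def)
    ultimately have "M (insert m (F - {y}))"
      using m(3) FK cF by (auto simp: M_def R_def)
    then have "card (insert m (F - {y}) \<inter> E) \<le> card (F \<inter> E)"
      by (rule most)
    moreover have "insert m (F - {y}) \<inter> E = insert m (F \<inter> E)" "m \<notin> F \<inter> E"
      using m(1,2) y by auto
    ultimately show False using D(1) by simp
  qed
  moreover have "card F \<le> b"
    using F bounded[of F] by (simp add: M_def)
  ultimately show "\<exists>G. G \<noteq> {} \<and> G \<subseteq> join_extreme_points K \<and> finite G \<and> card G \<le> b \<and> x = Sup_fin G"
    using D(1-3) unfolding E_def by blast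
qed

end
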